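(* Let $\mathfrak{H},\mathfrak{K},\mathfrak{L}$ be finite-dimensional Hilbert spaces equipped with error bases $\mathcal{E},\mathcal{F},\mathcal{E}'$ respectively, and let $\mathcal{A}:\mathfrak{H}\leadsto\mathfrak{K}$ and $\mathcal{B}:\mathfrak{K}\leadsto\mathfrak{L}$ be quantum channels. Then $\mathbf{C}(\mathcal{B}\circ\mathcal{A})=\mathbf{C}(\mathcal{A})\,\mathbf{C}(\mathcal{B})$ (matrix product); that is, for all $E\in\mathcal{E}$ and $E'\in\mathcal{E}'$, $$C(\mathcal{B}\circ\mathcal{A})^{E}_{E'}=\sum_{F\in\mathcal{F}}C(\mathcal{A})^{E}_{F}\;C(\mathcal{B})^{F}_{E'}.$$
   Context: Error basis: an error basis on a Hilbert space $\mathfrak{H}$ is a basis $\mathcal{E}$ of $L(\mathfrak{H})$ consisting of unitary operators, such that $I\in\mathcal{E}$; $\mathrm{Tr}(E^\dagger F)=0$ for distinct $E,F\in\mathcal{E}$; and $EF=\omega(E,F)FE$ for all $E,F\in\mathcal{E}$, where $\omega(E,F)\in\mathbb{C}$ satisfies $\omega(E,F)^r=1$ for some fixed $r$. $\mathcal{A}:\mathfrak{H}\leadsto\mathfrak{K}$ denotes a quantum channel from operators on $\mathfrak{H}$ to operators on $\mathfrak{K}$, $\mathcal{A}(\rho)=\sum_jA_j\rho A_j^\dagger$ with Kraus operators $A_j\in L(\mathfrak{H},\mathfrak{K})$. Circuit tensor: fix an orthonormal basis $\{|x\rangle\}$ of each Hilbert space, with respect to which complex conjugates $E^*$ are taken.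 For $A\in L(\mathfrak{H},\mathfrak{K})$ the Choi state is $|T_A\rangle=\frac{1}{\sqrt{\dim\mathfrak{H}}}\sum_x|x\rangle\otimes A|x\rangle\in\mathfrak{H}\otimes\mathfrak{K}$. The Choi matrix of $\mathcal{A}$ is $T_{\mathcal{A}}=\sum_j|T_{A_j}\rangle\langle T_{A_j}|$ (independent of the choice of Kraus operators). The circuit tensor of $\mathcal{A}$ has entries $C(\mathcal{A})^E_{F}=\mathrm{Tr}((E^*\otimes F)T_{\mathcal{A}})$ for $E\in\mathcal{E}$, $F\in\mathcal{F}$, and $\mathbf{C}(\mathcal{A})$ denotes the matrix with rows indexed by $\mathcal{E}$, columns by $\mathcal{F}$, and these entries. *)

theory Defs
  imports "HOL-Analysis.Analysis"
begin

text \<open>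
  A finite-dimensional Hilbert space with its fixed orthonormal basis is \<open>complex ^ 'n\<close> with the
  standard basis \<open>axis x 1\<close>, and operators are matrices in these bases: a linear map from
  \<open>complex ^ 'h\<close> to \<open>complex ^ 'k\<close> has type \<open>complex ^ 'h ^ 'k\<close>. The tensor product of
  \<open>complex ^ 'h\<close> and \<open>complex ^ 'k\<close> is \<open>complex ^ ('h \<times> 'k)\<close>.
\<close>

definition adj :: "complex ^ 'n ^ 'm \<Rightarrow> complex ^ 'm ^ 'n" where
  "adj A = (\<chi> i j. cnj (A $ j $ i))"

definition unitary :: "complex ^ 'n ^ 'n \<Rightarrow> bool" where
  "unitary U \<longleftrightarrow> adj U ** U = mat 1 \<and> U ** adj U = mat 1"

text \<open>
  The library's \<open>*\<^sub>R\<close> only makes matrices a real vector space, whose \<open>independent\<close> and \<open>span\<close>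
  are not the complex ones.
\<close>

definition mscale :: "complex \<Rightarrow> complex ^ 'n ^ 'm \<Rightarrow> complex ^ 'n ^ 'm"  (infixr "*\<^sub>M" 75) where
  "c *\<^sub>M A = map_matrix ((*) c) A"

interpretation cmat: vector_space "mscale :: complex \<Rightarrow> complex ^ 'n ^ 'm \<Rightarrow> complex ^ 'n ^ 'm"
  by unfold_locales (simp_all add: mscale_def vec_eq_iff algebra_simps)

definition error_basis :: "(complex ^ 'n ^ 'n) set \<Rightarrow> bool" where
  "error_basis \<E> \<longleftrightarrow>
     cmat.independent \<E> \<and> cmat.span \<E> = UNIV \<and>
     (\<forall>E\<in>\<E>. unitary E) \<and>
     mat 1 \<in> \<E> \<and>
     (\<forall>E\<in>\<E>. \<forall>F\<in>\<E>. E \<noteq> F \<longrightarrow> trace (adj E ** F) = 0) \<and>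
     (\<exists>r::nat. r > 0 \<and> (\<exists>\<omega> :: complex ^ 'n ^ 'n \<Rightarrow> complex ^ 'n ^ 'n \<Rightarrow> complex.
        \<forall>E\<in>\<E>. \<forall>F\<in>\<E>. E ** F = \<omega> E F *\<^sub>M (F ** E) \<and> \<omega> E F ^ r = 1))"

definition kraus_family ::
    "(complex ^ 'h ^ 'h \<Rightarrow> complex ^ 'k ^ 'k) \<Rightarrow> nat \<Rightarrow> (nat \<Rightarrow> complex ^ 'h ^ 'k) \<Rightarrow> bool" where
  "kraus_family \<Phi> n A \<longleftrightarrow> (\<forall>\<rho>. \<Phi> \<rho> = (\<Sum>j<n. A j ** \<rho> ** adj (A j)))"

text \<open>
  No normalisation \<open>(\<Sum>j<n. adj (A j) ** A j) = mat 1\<close> is imposed: trace-preserving channels are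
  included as a special case.
\<close>

definition quantum_channel :: "(complex ^ 'h ^ 'h \<Rightarrow> complex ^ 'k ^ 'k) \<Rightarrow> bool" where
  "quantum_channel \<Phi> \<longleftrightarrow> (\<exists>n A. kraus_family \<Phi> n A)"

definition tensor_vec :: "complex ^ 'h \<Rightarrow> complex ^ 'k \<Rightarrow> complex ^ ('h \<times> 'k)"  (infixr "\<otimes>\<^sub>v" 70) where
  "v \<otimes>\<^sub>v w = (\<chi> i. v $ fst i * w $ snd i)"

definition tensor_mat ::
    "complex ^ 'h ^ 'h \<Rightarrow> complex ^ 'k ^ 'k \<Rightarrow> complex ^ ('h \<times> 'k) ^ ('h \<times> 'k)"
    (infixr "\<otimes>\<^sub>m" 70) where
  "A \<otimes>\<^sub>m B = (\<chi> i j. A $ fst i $ fst j * B $ snd i $ snd j)"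

definition ketbra :: "complex ^ 'n \<Rightarrow> complex ^ 'm \<Rightarrow> complex ^ 'm ^ 'n" where
  "ketbra v w = (\<chi> i j. v $ i * cnj (w $ j))"

definition choi_state :: "complex ^ 'h ^ 'k \<Rightarrow> complex ^ ('h \<times> 'k)" where
  "choi_state A = (1 / complex_of_real (sqrt (real CARD('h)))) *s
     (\<Sum>x\<in>UNIV. axis x 1 \<otimes>\<^sub>v (A *v axis x 1))"

definition choi_of_kraus ::
    "nat \<Rightarrow> (nat \<Rightarrow> complex ^ 'h ^ 'k) \<Rightarrow> complex ^ ('h \<times> 'k) ^ ('h \<times> 'k)" where
  "choi_of_kraus n A = (\<Sum>j<n. ketbra (choi_state (A j)) (choi_state (A j)))"

text \<open>Well defined on channels by \<open>choi_matrix_eq\<close> below.\<close>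

definition choi_matrix ::
    "(complex ^ 'h ^ 'h \<Rightarrow> complex ^ 'k ^ 'k) \<Rightarrow> complex ^ ('h \<times> 'k) ^ ('h \<times> 'k)" where
  "choi_matrix \<Phi> = (THE T. \<exists>n A. kraus_family \<Phi> n A \<and> T = choi_of_kraus n A)"

text \<open>\<open>circuit_tensor \<Phi> E F\<close> is the entry in row \<open>E\<close> and column \<open>F\<close>.\<close>

definition circuit_tensor ::
    "(complex ^ 'h ^ 'h \<Rightarrow> complex ^ 'k ^ 'k) \<Rightarrow> complex ^ 'h ^ 'h \<Rightarrow> complex ^ 'k ^ 'k \<Rightarrow> complex" where
  "circuit_tensor \<Phi> E F = trace ((map_matrix cnj E \<otimes>\<^sub>m F) ** choi_matrix \<Phi>)"

lemma choi_state_nth: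
  fixes A :: "complex ^ 'h ^ 'k"
  shows "choi_state A $ (x, a) = A $ a $ x / complex_of_real (sqrt (real CARD('h)))"
proof -
  have "(\<Sum>y\<in>UNIV. axis y 1 \<otimes>\<^sub>v (A *v axis y 1)) $ (x, a)
        = (\<Sum>y\<in>UNIV. if y = x then A $ a $ x else 0)"
    unfolding sum_component
    by (rule sum.cong) (auto simp: tensor_vec_def axis_def matrix_vector_mult_def if_distrib cong: if_cong)
  then show ?thesis
    by (simp add: choi_state_def)
qed

lemma kraus_term_unit:
  fixes A :: "complex ^ 'h ^ 'k"
  shows "(A ** ketbra (axis x 1) (axis y 1) ** adj A) $ a $ b = A $ a $ x * cnj (A $ b $ y)"
proof -
  have "(A ** ketbra (axis x 1) (axis y 1)) $ a $ k = (if k = y then A $ a $ x else 0)" for k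
  proof -
    have "(A ** ketbra (axis x 1) (axis y 1)) $ a $ k
          = (\<Sum>l\<in>UNIV. if l = x then (if k = y then A $ a $ x else 0) else 0)"
      unfolding matrix_matrix_mult_def ketbra_def
      by (simp only: vec_lambda_beta, intro sum.cong) (auto simp: axis_def)
    then show ?thesis by simp
  qed
  then have "(A ** ketbra (axis x 1) (axis y 1) ** adj A) $ a $ b
          = (\<Sum>k\<in>UNIV. if k = y then A $ a $ x * cnj (A $ b $ y) else 0)"
    unfolding matrix_matrix_mult_def[of "A ** ketbra (axis x 1) (axis y 1)"] adj_def
    by (simp only: vec_lambda_beta, intro sum.cong) auto
  then show ?thesis by simp
qed

lemma choi_of_kraus_nth:
  fixes \<Phi> :: "complex ^ 'h ^ 'h \<Rightarrow> complex ^ 'k ^ 'k"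
  assumes "kraus_family \<Phi> n A"
  shows "choi_of_kraus n A $ (x, a) $ (y, b)
         = \<Phi> (ketbra (axis x 1) (axis y 1)) $ a $ b / of_nat CARD('h)"
proof -
  have sq: "complex_of_real (sqrt (real CARD('h))) * complex_of_real (sqrt (real CARD('h)))
        = of_nat CARD('h)"
    by (simp flip: of_real_mult)
  show ?thesis
    using assms
    by (simp add: kraus_family_def choi_of_kraus_def ketbra_def[of "choi_state _"]
        choi_state_nth kraus_term_unit sq sum_divide_distrib)
qed

lemma choi_matrix_eq:
  assumes "kraus_family \<Phi> n A"
  shows "choi_matrix \<Phi> = choi_of_kraus n A"
  unfolding choi_matrix_def
proof (rule the_equality)
  show "\<exists>m B. kraus_family \<Phi> m B \<and> choi_of_kraus n A = choi_of_kraus m B"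
    using assms by blast
next
  fix T assume "\<exists>m B. kraus_family \<Phi> m B \<and> T = choi_of_kraus m B"
  then show "T = choi_of_kraus n A"
    using assms by (auto simp: vec_eq_iff choi_of_kraus_nth)
qed

lemma adj_mult: "adj (A ** B) = adj B ** adj A"
  by (simp add: adj_def matrix_matrix_mult_def vec_eq_iff mult.commute)

lemma matrix_mult_sum_left: "(\<Sum>j\<in>S. f j) ** (B :: complex ^ 'n ^ 'm) = (\<Sum>j\<in>S. f j ** B)"
  by (induction S rule: infinite_finite_induct) (simp_all add: matrix_matrix_mult_def vec_eq_iff distrib_right sum.distrib)

lemma matrix_mult_sum_right: "(B :: complex ^ 'n ^ 'm) ** (\<Sum>j\<in>S. f j) = (\<Sum>j\<in>S. B ** f j)"
  by (induction S rule: infinite_finite_induct) (simp_all add: matrix_matrix_mult_def vec_eq_iff distrib_left sum.distrib)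

lemma quantum_channel_comp:
  fixes \<Phi> :: "complex ^ 'h ^ 'h \<Rightarrow> complex ^ 'k ^ 'k" and \<Psi> :: "complex ^ 'k ^ 'k \<Rightarrow> complex ^ 'l ^ 'l"
  assumes "quantum_channel \<Phi>" and "quantum_channel \<Psi>"
  shows "quantum_channel (\<Psi> \<circ> \<Phi>)"
proof -
  obtain n A m B where A: "kraus_family \<Phi> n A" and B: "kraus_family \<Psi> m B"
    using assms by (auto simp: quantum_channel_def)
  define K where "K = (\<lambda>i. B (i div n) ** A (i mod n))"
  have "(\<Psi> \<circ> \<Phi>) \<rho> = (\<Sum>i<m * n. K i ** \<rho> ** adj (K i))" for \<rho>
  proof -
    have "(\<Psi> \<circ> \<Phi>) \<rho> = (\<Sum>i<m. \<Sum>j<n. B i ** A j ** \<rho> ** adj (B i ** A j))"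
      using A B
      by (simp add: kraus_family_def adj_mult matrix_mult_sum_left matrix_mult_sum_right
          matrix_mul_assoc)
    also have "\<dots> = (\<Sum>i<m. \<Sum>j<n. K (j + i * n) ** \<rho> ** adj (K (j + i * n)))"
      by (simp add: K_def)
    also have "\<dots> = (\<Sum>i<m * n. K i ** \<rho> ** adj (K i))"
      using sum.shift_bounds_nat_ivl[of "\<lambda>i. K i ** \<rho> ** adj (K i)" 0 "_ * n" n]
      by (simp add: sum.nat_group[symmetric] atLeast0LessThan add.commute)
    finally show ?thesis .
  qed
  then show ?thesis
    by (auto simp: quantum_channel_def kraus_family_def)
qed

end

theory Submission
  imports Defs
begin

text \<open>
  Contracting the Choi matrix turns the circuit tensor into a Hilbert--Schmidt pairing,
  \<open>circuit_tensor \<Phi> E F = trace (F ** \<Phi> (adj E)) / d\<close> with \<open>d\<close> the dimension of the input space.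
  An error basis consists of orthogonal matrices of squared norm \<open>d\<close>, so every operator \<open>X\<close> on the
  middle space is the sum over \<open>F\<close> of \<open>trace (F ** X) / d\<close> times \<open>adj F\<close>. Expanding
  \<open>\<A> (adj E)\<close> in this way and applying the linear map \<open>\<B>\<close> gives the matrix product.
\<close>

text \<open>Indexing the matrix units by pairs keeps this a single sum, the form to which
  \<open>cmat.span_sum\<close> and \<open>quantum_channel_sum_mscale\<close> apply.\<close>

lemma matrix_eq_sum_units:
  fixes X :: "complex ^ 'n ^ 'm"
  shows "X = (\<Sum>p\<in>UNIV. X $ fst p $ snd p *\<^sub>M ketbra (axis (fst p) 1) (axis (snd p) 1))"
proof -
  have "(\<Sum>p\<in>UNIV. X $ fst p $ snd p *\<^sub>M ketbra (axis (fst p) 1) (axis (snd p) 1)) $ i $ j = X $ i $ j"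
    for i j
  proof -
    have "(\<Sum>p\<in>UNIV. X $ fst p $ snd p *\<^sub>M ketbra (axis (fst p) 1) (axis (snd p) 1)) $ i $ j
        = (\<Sum>p\<in>UNIV. if p = (i, j) then X $ i $ j else 0)"
      unfolding sum_component
      by (rule sum.cong) (auto simp: mscale_def ketbra_def axis_def)
    then show ?thesis by simp
  qed
  then show ?thesis by (simp add: vec_eq_iff)
qed

text \<open>The finitely many matrix units span the space and so bound the size of an independent
  set. For an error basis this keeps sums over it from collapsing to the default value 0.\<close>

lemma finite_if_cmat_independent:
  fixes S :: "(complex ^ 'n ^ 'm) set"
  assumes "cmat.independent S"
  shows "finite S"
proof -
  let ?U = "range (\<lambda>p :: 'm \<times> 'n. ketbra (axis (fst p) 1) (axis (snd p) 1) :: complex ^ 'n ^ 'm)"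
  have "X \<in> cmat.span ?U" for X :: "complex ^ 'n ^ 'm"
    by (subst matrix_eq_sum_units) (intro cmat.span_sum cmat.span_scale cmat.span_base rangeI)
  then show ?thesis
    using cmat.independent_span_bound[of ?U S] assms by auto
qed

lemma matrix_mult_mscale_left: "(c *\<^sub>M A) ** B = c *\<^sub>M (A ** B)"
  by (simp add: mscale_def matrix_matrix_mult_def vec_eq_iff sum_distrib_left mult.assoc)

lemma matrix_mult_mscale_right: "A ** (c *\<^sub>M B) = c *\<^sub>M (A ** B)"
  by (simp add: mscale_def matrix_matrix_mult_def vec_eq_iff sum_distrib_left mult.left_commute)

lemma trace_mscale: "trace (c *\<^sub>M A) = c * trace A"
  by (simp add: mscale_def trace_def sum_distrib_left)

lemma trace_sum: "trace (\<Sum>i\<in>S. f i :: complex ^ 'n ^ 'n) = (\<Sum>i\<in>S. trace (f i))"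
  by (simp add: trace_def sum.swap[of _ S])

lemma adj_adj [simp]: "adj (adj A) = A"
  by (simp add: adj_def vec_eq_iff)

lemma adj_mscale: "adj (c *\<^sub>M A) = cnj c *\<^sub>M adj A"
  by (simp add: adj_def mscale_def vec_eq_iff)

lemma adj_sum: "adj (\<Sum>i\<in>S. f i) = (\<Sum>i\<in>S. adj (f i))"
  by (simp add: adj_def vec_eq_iff)

lemma cnj_trace: "cnj (trace A) = trace (adj A)"
  by (simp add: adj_def trace_def)

lemma quantum_channel_sum_mscale:
  assumes "quantum_channel \<Phi>"
  shows "\<Phi> (\<Sum>i\<in>S. c i *\<^sub>M X i) = (\<Sum>i\<in>S. c i *\<^sub>M \<Phi> (X i))"
proof -
  obtain n :: nat and A where "\<And>\<rho>. \<Phi> \<rho> = (\<Sum>j<n. A j ** \<rho> ** adj (A j))"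
    using assms unfolding quantum_channel_def kraus_family_def by blast
  then show ?thesis
    by (simp add: matrix_mult_sum_left matrix_mult_sum_right matrix_mult_mscale_left
        matrix_mult_mscale_right cmat.scale_sum_right sum.swap[of _ S])
qed

lemma choi_matrix_nth:
  fixes \<Phi> :: "complex ^ 'h ^ 'h \<Rightarrow> complex ^ 'k ^ 'k"
  assumes "quantum_channel \<Phi>"
  shows "choi_matrix \<Phi> $ (x, a) $ (y, b)
         = \<Phi> (ketbra (axis x 1) (axis y 1)) $ a $ b / of_nat CARD('h)"
  using assms by (auto simp: quantum_channel_def choi_matrix_eq choi_of_kraus_nth)

text \<open>The Choi entry at \<open>(y, b)\<close>, \<open>(x, a)\<close> comes from \<Phi> applied
  to the matrix unit in row \<open>y\<close> and column \<open>x\<close>. Weighting these units by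
  \<open>cnj (E $ x $ y)\<close> assembles \<open>adj E\<close>, by linearity of \<Phi>.\<close>

lemma circuit_tensor_eq_trace:
  fixes \<Phi> :: "complex ^ 'h ^ 'h \<Rightarrow> complex ^ 'k ^ 'k"
  assumes "quantum_channel \<Phi>"
  shows "circuit_tensor \<Phi> E F = trace (F ** \<Phi> (adj E)) / of_nat CARD('h)"
proof -
  let ?u = "\<lambda>x y. ketbra (axis x 1) (axis y 1) :: complex ^ 'h ^ 'h"
  have pairs: "(\<Sum>p\<in>UNIV. f p) = (\<Sum>x\<in>UNIV. \<Sum>y\<in>UNIV. f (x, y))"
    for f :: "'u::finite \<times> 'v::finite \<Rightarrow> complex"
    by (simp add: sum.cartesian_product)
  have "\<Phi> (adj E) = (\<Sum>p\<in>UNIV. adj E $ fst p $ snd p *\<^sub>M \<Phi> (?u (fst p) (snd p)))"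
    by (subst matrix_eq_sum_units) (rule quantum_channel_sum_mscale[OF assms])
  then have "trace (F ** \<Phi> (adj E))
      = (\<Sum>p\<in>UNIV. adj E $ fst p $ snd p * trace (F ** \<Phi> (?u (fst p) (snd p))))"
    by (simp add: matrix_mult_sum_right matrix_mult_mscale_right trace_sum trace_mscale)
  also have "\<dots> = (\<Sum>y\<in>UNIV. \<Sum>x\<in>UNIV. \<Sum>a\<in>UNIV. \<Sum>b\<in>UNIV.
      cnj (E $ x $ y) * F $ a $ b * \<Phi> (?u y x) $ b $ a)"
    by (simp add: pairs adj_def trace_def matrix_matrix_mult_def sum_distrib_left mult.assoc)
  \<comment> \<open>This order matches the tensor product: \<open>(x, a)\<close> is the diagonal
    index of the trace, \<open>(y, b)\<close> the summation index of the matrix product.\<close>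
  also have "\<dots> = (\<Sum>x\<in>UNIV. \<Sum>a\<in>UNIV. \<Sum>y\<in>UNIV. \<Sum>b\<in>UNIV.
      cnj (E $ x $ y) * F $ a $ b * \<Phi> (?u y x) $ b $ a)"
    by (subst sum.swap, intro sum.cong refl, subst sum.swap, rule refl)
  also have "\<dots> / of_nat CARD('h) = circuit_tensor \<Phi> E F"
    by (simp add: circuit_tensor_def trace_def tensor_mat_def matrix_matrix_mult_def pairs
        choi_matrix_nth[OF assms] sum_divide_distrib)
  finally show ?thesis ..
qed

lemma error_basis_expansion:
  fixes \<F> :: "(complex ^ 'k ^ 'k) set"
  assumes "error_basis \<F>"
  shows "X = (\<Sum>F\<in>\<F>. (trace (F ** X) / of_nat CARD('k)) *\<^sub>M adj F)"
proof -
  have fin: "finite \<F>"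
    using assms finite_if_cmat_independent by (auto simp: error_basis_def)
  \<comment> \<open>Expanding \<open>adj X\<close> and then taking adjoints expresses X in the
    operators \<open>adj F\<close>, without a separate proof that these span.\<close>
  then obtain c where c: "adj X = (\<Sum>F\<in>\<F>. c F *\<^sub>M F)"
    using assms cmat.span_finite[OF fin] unfolding error_basis_def
    by (metis (no_types, lifting) UNIV_I imageE)
  have X: "X = (\<Sum>F\<in>\<F>. cnj (c F) *\<^sub>M adj F)"
    using arg_cong[OF c, of adj] by (simp add: adj_sum adj_mscale)
  have "trace (G ** X) / of_nat CARD('k) = cnj (c G)" if "G \<in> \<F>" for G
  proof -
    \<comment> \<open>Cyclicity of the trace gives \<open>trace (adj F ** G)\<close>: orthogonality
      makes it vanish for distinct operators, and unitarity makes it the trace of the identity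
      otherwise.\<close>
    have tr: "trace (G ** adj F) = (if F = G then of_nat CARD('k) else 0)" if "F \<in> \<F>" for F
      using assms \<open>G \<in> \<F>\<close> that cnj_trace[of "G ** adj F"]
      by (auto simp: error_basis_def unitary_def trace_I trace_mul_sym[of G])
    have "trace (G ** X) = (\<Sum>F\<in>\<F>. cnj (c F) * trace (G ** adj F))"
      by (subst X) (simp add: matrix_mult_sum_right matrix_mult_mscale_right trace_sum trace_mscale)
    also have "\<dots> = (\<Sum>F\<in>\<F>. if F = G then cnj (c G) * of_nat CARD('k) else 0)"
      by (rule sum.cong) (auto simp: tr)
    finally show ?thesis
      using fin that by simp
  qed
  then show ?thesis
    using X by simp
qed

theorem theorem29:
  fixes \<E> :: "(complex ^ 'h ^ 'h) set"
    and \<F> :: "(complex ^ 'k ^ 'k) set"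
    and \<E>' :: "(complex ^ 'l ^ 'l) set"
    and \<A> :: "complex ^ 'h ^ 'h \<Rightarrow> complex ^ 'k ^ 'k"
    and \<B> :: "complex ^ 'k ^ 'k \<Rightarrow> complex ^ 'l ^ 'l"
  assumes "error_basis \<E>" and "error_basis \<F>" and "error_basis \<E>'"
    and "quantum_channel \<A>" and "quantum_channel \<B>"
  shows "\<forall>E\<in>\<E>. \<forall>E'\<in>\<E>'.
    circuit_tensor (\<B> \<circ> \<A>) E E' = (\<Sum>F\<in>\<F>. circuit_tensor \<A> E F * circuit_tensor \<B> F E')"
proof (intro ballI)
  fix E E'
  let ?Y = "\<A> (adj E)"
  have "\<B> ?Y = (\<Sum>F\<in>\<F>. (trace (F ** ?Y) / of_nat CARD('k)) *\<^sub>M \<B> (adj F))"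
    by (subst error_basis_expansion[OF assms(2), of ?Y])
      (rule quantum_channel_sum_mscale[OF assms(5)])
  then have "trace (E' ** \<B> ?Y)
      = (\<Sum>F\<in>\<F>. trace (F ** ?Y) / of_nat CARD('k) * trace (E' ** \<B> (adj F)))"
    by (simp add: matrix_mult_sum_right matrix_mult_mscale_right trace_sum trace_mscale)
  \<comment> \<open>The factor \<open>1 / CARD('k)\<close> of the expansion normalises the tensor of
    \<B>; the factor \<open>1 / CARD('h)\<close> of the composite normalises that of \<A>.\<close>
  then show "circuit_tensor (\<B> \<circ> \<A>) E E'
      = (\<Sum>F\<in>\<F>. circuit_tensor \<A> E F * circuit_tensor \<B> F E')"
    using assms(4,5)
    by (simp add: circuit_tensor_eq_trace quantum_channel_comp sum_divide_distrib)
      (simp add: mult.commute)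
qed

end
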